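(* Let $(X,r)$ be a finite bijective non-degenerate set-theoretic solution of the Yang-Baxter equation. Then $(X,r)$ is indecomposable if and only if its permutation group $\mathcal{G}(X,r)$ acts transitively on $X$.
   Context: A set-theoretic solution of the Yang-Baxter equation on a non-empty set $X$ is a pair $(X,r)$ with $r:X\times X\to X\times X$ a map such that $(r\times \mathrm{id}_X)(\mathrm{id}_X\times r)(r\times \mathrm{id}_X)=(\mathrm{id}_X\times r)(r\times \mathrm{id}_X)(\mathrm{id}_X\times r)$. Write $r(x,y)=(\lambda_x(y),\rho_y(x))$ with $\lambda_x,\rho_x:X\to X$. The solution is bijective if $r$ is bijective, and non-degenerate if $\lambda_x,\rho_x\in\mathrm{Sym}_X$ for every $x\in X$. It is decomposable if there is a partition $\{X_1,X_2\}$ of $X$ into two non-empty subsets such that $r(X_i\times X_j)=X_j\times X_i$ for all $i,j\in\{1,2\}$; otherwise it is indecomposable. For $x\in X$ let $\eta_x$ be the permutation of $X$ given by $\eta_x(y):=\rho_{\lambda_y^{-1}(x)}(y)$ for all $y\in X$. The permutation group associated to $(X,r)$ is the subgroup $\mathcal{G}(X,r):=\langle \lambda_x,\eta_x\mid x\in X\rangle$ of $\mathrm{Sym}_X$. *)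

theory Defs
  imports "HOL-Algebra.Group_Action" "HOL-Algebra.Generated_Groups"
    "HOL-Library.Disjoint_Sets"
begin

text \<open>Triples are right-nested pairs, so \<open>r \<times> id\<close> needs a definition of its own,
  whereas \<open>id \<times> r\<close> is \<open>map_prod id r\<close>.\<close>

definition on_first_two :: "('a \<times> 'a \<Rightarrow> 'a \<times> 'a) \<Rightarrow> 'a \<times> 'a \<times> 'a \<Rightarrow> 'a \<times> 'a \<times> 'a"
  where "on_first_two r = (\<lambda>(x, y, z). (fst (r (x, y)), snd (r (x, y)), z))"

definition on_last_two :: "('a \<times> 'a \<Rightarrow> 'a \<times> 'a) \<Rightarrow> 'a \<times> 'a \<times> 'a \<Rightarrow> 'a \<times> 'a \<times> 'a"
  where "on_last_two r = map_prod id r"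

text \<open>Only the values of \<open>r\<close> on \<open>X \<times> X\<close> are relevant in what follows.\<close>

definition ybe_solution :: "'a set \<Rightarrow> ('a \<times> 'a \<Rightarrow> 'a \<times> 'a) \<Rightarrow> bool"
  where "ybe_solution X r \<longleftrightarrow>
    X \<noteq> {} \<and> r \<in> X \<times> X \<rightarrow> X \<times> X \<and>
    (\<forall>t \<in> X \<times> X \<times> X.
      (on_first_two r \<circ> on_last_two r \<circ> on_first_two r) t =
      (on_last_two r \<circ> on_first_two r \<circ> on_last_two r) t)"

text \<open>\<open>r (x, y) = (\<lambda>\<^sub>x(y), \<rho>\<^sub>y(x))\<close>: the subscript of \<open>\<rho>\<close> is the second argument of \<open>r\<close>.
  The maps are restricted to \<open>X\<close> because the elements of \<^const>\<open>BijGroup\<close> are extensional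
  functions.\<close>

definition lambda_map :: "'a set \<Rightarrow> ('a \<times> 'a \<Rightarrow> 'a \<times> 'a) \<Rightarrow> 'a \<Rightarrow> 'a \<Rightarrow> 'a"
  where "lambda_map X r x = (\<lambda>y \<in> X. fst (r (x, y)))"

definition rho_map :: "'a set \<Rightarrow> ('a \<times> 'a \<Rightarrow> 'a \<times> 'a) \<Rightarrow> 'a \<Rightarrow> 'a \<Rightarrow> 'a"
  where "rho_map X r y = (\<lambda>x \<in> X. snd (r (x, y)))"

definition nondegenerate :: "'a set \<Rightarrow> ('a \<times> 'a \<Rightarrow> 'a \<times> 'a) \<Rightarrow> bool"
  where "nondegenerate X r \<longleftrightarrow> (\<forall>x \<in> X. lambda_map X r x \<in> Bij X \<and> rho_map X r x \<in> Bij X)"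

definition eta_map :: "'a set \<Rightarrow> ('a \<times> 'a \<Rightarrow> 'a \<times> 'a) \<Rightarrow> 'a \<Rightarrow> 'a \<Rightarrow> 'a"
  where "eta_map X r x = (\<lambda>y \<in> X. rho_map X r (inv_into X (lambda_map X r y) x) y)"

definition decomposable :: "'a set \<Rightarrow> ('a \<times> 'a \<Rightarrow> 'a \<times> 'a) \<Rightarrow> bool"
  where "decomposable X r \<longleftrightarrow>
    (\<exists>X1 X2. X1 \<noteq> X2 \<and> partition_on X {X1, X2} \<and>
      (\<forall>A \<in> {X1, X2}. \<forall>B \<in> {X1, X2}. r ` (A \<times> B) = B \<times> A))"

abbreviation indecomposable :: "'a set \<Rightarrow> ('a \<times> 'a \<Rightarrow> 'a \<times> 'a) \<Rightarrow> bool"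
  where "indecomposable X r \<equiv> \<not> decomposable X r"

definition permutation_group :: "'a set \<Rightarrow> ('a \<times> 'a \<Rightarrow> 'a \<times> 'a) \<Rightarrow> ('a \<Rightarrow> 'a) monoid"
  where "permutation_group X r =
    (BijGroup X) \<lparr>carrier := generate (BijGroup X) (lambda_map X r ` X \<union> eta_map X r ` X)\<rparr>"

text \<open>\<^const>\<open>generate\<close> yields the subgroup generated by a set only if that set lies in the
  carrier; the following lemmas show that this is the case here.\<close>

lemma eta_map_in_Bij:
  assumes rb: "bij_betw r (X \<times> X) (X \<times> X)" and nd: "nondegenerate X r" and x: "x \<in> X"
  shows "eta_map X r x \<in> Bij X"
proof -
  define z where "z y = inv_into X (lambda_map X r y) x" for y
  have lb: "bij_betw (lambda_map X r y) X X" if "y \<in> X" for y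
    using nd that by (simp add: nondegenerate_def Bij_def)
  have zX: "z y \<in> X" if "y \<in> X" for y
    using lb[OF that] x by (simp add: z_def bij_betw_def inv_into_into)
  have lz: "lambda_map X r y (z y) = x" if "y \<in> X" for y
    unfolding z_def using bij_betw_inv_into_right[OF lb[OF that] x] .
  have eta: "r (y, z y) = (x, eta_map X r x y)" if "y \<in> X" for y
    using lz[OF that] zX[OF that] that
    by (auto simp: eta_map_def rho_map_def lambda_map_def z_def prod_eq_iff)
  have inj: "inj_on (eta_map X r x) X"
  proof (rule inj_onI)
    fix y y' assume y: "y \<in> X" "y' \<in> X" and eq: "eta_map X r x y = eta_map X r x y'"
    then have "r (y, z y) = r (y', z y')"
      using eta by simp
    then show "y = y'"
      using inj_onD[OF bij_betw_imp_inj_on[OF rb], of "(y, z y)" "(y', z y')"] y zX by auto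
  qed
  have img: "eta_map X r x ` X = X"
  proof (intro equalityI subsetI)
    fix w assume "w \<in> eta_map X r x ` X"
    then obtain y where y: "y \<in> X" "w = eta_map X r x y" by auto
    have "r (y, z y) \<in> X \<times> X"
      using bij_betwE[OF rb] y zX by auto
    then show "w \<in> X" using eta[OF y(1)] y(2) by simp
  next
    fix w assume w: "w \<in> X"
    have "(x, w) \<in> r ` (X \<times> X)"
      using rb w x by (simp add: bij_betw_def)
    then obtain y v where yv: "y \<in> X" "v \<in> X" and r: "r (y, v) = (x, w)" by auto
    have "lambda_map X r y v = x"
      using r yv by (simp add: lambda_map_def)
    then have "z y = v"
      using bij_betw_inv_into_left[OF lb[OF yv(1)] yv(2)] by (simp add: z_def)
    then have "eta_map X r x y = w"
      using eta[OF yv(1)] r by simp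
    then show "w \<in> eta_map X r x ` X" using yv by auto
  qed
  show ?thesis
    using inj img by (auto simp: Bij_def bij_betw_def eta_map_def)
qed

lemma subgroup_permutation_group:
  assumes "bij_betw r (X \<times> X) (X \<times> X)" "nondegenerate X r"
  shows "subgroup (carrier (permutation_group X r)) (BijGroup X)"
proof -
  have "lambda_map X r ` X \<union> eta_map X r ` X \<subseteq> carrier (BijGroup X)"
    using assms eta_map_in_Bij[OF assms] by (auto simp: BijGroup_def nondegenerate_def)
  from group.generate_is_subgroup[OF group_BijGroup this] show ?thesis
    by (simp add: permutation_group_def)
qed

end

theory Submission
  imports Defs
begin

text \<open>Since \<open>\<eta>\<^sub>x\<close> is designed to satisfy \<open>r (x, y) = (\<lambda>\<^sub>x(y), \<eta>\<^bsub>\<lambda>\<^sub>x(y)\<^esub>(x))\<close>, the block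
  in which each component of \<open>r (x, y)\<close> lies is governed by the generators of the permutation
  group: the \<open>\<lambda>\<close>-maps move \<open>y\<close> into the first component and the \<open>\<eta>\<close>-maps move \<open>x\<close> into
  the second. Hence a splitting \<open>X = A \<union> (X - A)\<close> is a decomposition exactly when every
  \<open>\<lambda>\<^sub>x\<close> and every \<open>\<eta>\<^sub>x\<close> preserves membership in \<open>A\<close> (lemma \<open>block_swap_iff_generators_preserve\<close>;
  surjectivity of \<open>r\<close> turns the inclusions between blocks into equalities). Membership in \<open>A\<close>
  is then preserved by the whole generated group (lemma \<open>generate_preserves_iff\<close>), and a group
  acts transitively exactly when the only invariant sets are \<open>{}\<close> and \<open>X\<close>, because an orbit is
  itself invariant (lemma \<open>transitive_action_iff_no_invariant\<close>).\<close>

text \<open>Invariance is stated as an equivalence, not as \<open>h ` A \<subseteq> A\<close>: in this form it is inherited by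
  inverses, also when \<open>A\<close> is infinite.\<close>

lemma generate_preserves_iff:
  assumes H: "H \<subseteq> Bij X"
  shows "(\<forall>g \<in> generate (BijGroup X) H. \<forall>x \<in> X. g x \<in> A \<longleftrightarrow> x \<in> A) \<longleftrightarrow>
    (\<forall>h \<in> H. \<forall>x \<in> X. h x \<in> A \<longleftrightarrow> x \<in> A)"
proof (rule iffI; intro ballI)
  fix h x
  assume "\<forall>g \<in> generate (BijGroup X) H. \<forall>x \<in> X. g x \<in> A \<longleftrightarrow> x \<in> A" "h \<in> H" "x \<in> X"
  then show "h x \<in> A \<longleftrightarrow> x \<in> A"
    by (simp add: generate.incl)
next
  fix g x
  assume inv: "\<forall>h \<in> H. \<forall>x \<in> X. h x \<in> A \<longleftrightarrow> x \<in> A"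
  interpret B: group "BijGroup X"
    by (rule group_BijGroup)
  have mult: "(f \<otimes>\<^bsub>BijGroup X\<^esub> g) x = f (g x)"
    if "f \<in> Bij X" "g \<in> Bij X" "x \<in> X" for f g x
    using that by (simp add: BijGroup_def compose_eq)
  have maps: "g x \<in> X" if "g \<in> Bij X" "x \<in> X" for g x
    using that Bij_imp_funcset by blast
  have gen: "g \<in> Bij X" if "g \<in> generate (BijGroup X) H" for g
    using B.generate_in_carrier[of H g] that H by (simp add: BijGroup_def)
  assume "g \<in> generate (BijGroup X) H" "x \<in> X"
  then show "g x \<in> A \<longleftrightarrow> x \<in> A"
  proof (induction arbitrary: x rule: generate.induct)
    case one
    then show ?case by (simp add: BijGroup_def)
  next
    case (incl h)
    then show ?case using inv by simp
  next
    case (inv h)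
    let ?i = "inv\<^bsub>BijGroup X\<^esub> h"
    have h: "h \<in> Bij X" and i: "?i \<in> Bij X"
      using inv.hyps H gen[OF generate.inv] by auto
    have "h (?i x) = (h \<otimes>\<^bsub>BijGroup X\<^esub> ?i) x"
      using mult[OF h i inv.prems] by simp
    also have "\<dots> = x"
      using h inv.prems B.r_inv[of h] by (simp add: BijGroup_def)
    finally show ?case
      using \<open>\<forall>h \<in> H. \<forall>x \<in> X. h x \<in> A \<longleftrightarrow> x \<in> A\<close> inv.hyps maps[OF i inv.prems] by metis
  next
    case (eng g1 g2)
    then show ?case
      using mult[OF gen gen] maps[OF gen] by simp
  qed
qed

lemma transitive_action_iff_no_invariant:
  assumes "group_action G E \<phi>"
  shows "transitive_action G E \<phi> \<longleftrightarrow>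
    \<not> (\<exists>A \<subset> E. A \<noteq> {} \<and> (\<forall>g \<in> carrier G. \<forall>x \<in> E. \<phi> g x \<in> A \<longleftrightarrow> x \<in> A))"
proof -
  interpret group_action G E \<phi> by fact
  interpret group G
    using group_hom group_hom.axioms(1) by auto
  show ?thesis
  proof (intro iffI notI)
    assume "transitive_action G E \<phi>"
    then have trans: "\<exists>g \<in> carrier G. \<phi> g x = y" if "x \<in> E" "y \<in> E" for x y
      using that by (rule transitive_action.unique_orbit)
    assume "\<exists>A \<subset> E. A \<noteq> {} \<and> (\<forall>g \<in> carrier G. \<forall>x \<in> E. \<phi> g x \<in> A \<longleftrightarrow> x \<in> A)"
    then obtain A x y where "\<forall>g \<in> carrier G. \<forall>x \<in> E. \<phi> g x \<in> A \<longleftrightarrow> x \<in> A"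
      "x \<in> E" "y \<in> E" "x \<in> A" "y \<notin> A"
      by blast
    then show False
      using trans by metis
  next
    assume none: "\<not> (\<exists>A \<subset> E. A \<noteq> {} \<and> (\<forall>g \<in> carrier G. \<forall>x \<in> E. \<phi> g x \<in> A \<longleftrightarrow> x \<in> A))"
    have "\<exists>g \<in> carrier G. \<phi> g x = y" if x: "x \<in> E" and y: "y \<in> E" for x y
    proof -
      let ?A = "orbit G \<phi> x"
      have sub: "?A \<subseteq> E"
        using x element_image by (auto simp: orbit_def)
      have step: "\<phi> g z \<in> ?A" if g: "g \<in> carrier G" and z: "z \<in> ?A" for g z
      proof -
        obtain k where k: "k \<in> carrier G" "z = \<phi> k x"
          using z by (auto simp: orbit_def)
        then have "\<phi> g z = \<phi> (g \<otimes>\<^bsub>G\<^esub> k) x"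
          using composition_rule[OF x g] by simp
        then show ?thesis
          using k g by (auto simp: orbit_def)
      qed
      have "\<phi> g z \<in> ?A \<longleftrightarrow> z \<in> ?A" if g: "g \<in> carrier G" and z: "z \<in> E" for g z
        using step[OF g] step[OF inv_closed[OF g]] orbit_sym_aux[OF g z refl] by metis
      then have "?A = E"
        using none sub orbit_refl[OF x] by blast
      then show ?thesis
        using y by (auto simp: orbit_def)
    qed
    then show "transitive_action G E \<phi>"
      by unfold_locales
  qed
qed

lemma solution_via_eta:
  assumes nd: "nondegenerate X r" and x: "x \<in> X" and y: "y \<in> X"
  shows "r (x, y) = (lambda_map X r x y, eta_map X r (lambda_map X r x y) x)"
proof -
  have "bij_betw (lambda_map X r x) X X"
    using nd x by (simp add: nondegenerate_def Bij_def)
  then have "inv_into X (lambda_map X r x) (lambda_map X r x y) = y"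
    using y by (rule bij_betw_inv_into_left)
  then show ?thesis
    using x y by (simp add: eta_map_def rho_map_def lambda_map_def prod_eq_iff)
qed

text \<open>Both sides say that \<open>r\<close> exchanges the memberships of its arguments in \<open>A\<close>. Every pair
  \<open>(x, y)\<close> yields one instance for \<open>\<lambda>\<^sub>x\<close> at \<open>y\<close> and one for \<open>\<eta>\<^bsub>\<lambda>\<^sub>x(y)\<^esub>\<close> at \<open>x\<close>; as
  \<open>\<lambda>\<^sub>x\<close> is onto, every \<open>\<eta>\<^sub>z\<close> at every \<open>x\<close> is reached in this way.\<close>

lemma block_swap_iff_generators_preserve:
  assumes rb: "bij_betw r (X \<times> X) (X \<times> X)" and nd: "nondegenerate X r" and A: "A \<subseteq> X"
  shows "(\<forall>P \<in> {A, X - A}. \<forall>Q \<in> {A, X - A}. r ` (P \<times> Q) = Q \<times> P) \<longleftrightarrow>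
    (\<forall>h \<in> lambda_map X r ` X \<union> eta_map X r ` X. \<forall>x \<in> X. h x \<in> A \<longleftrightarrow> x \<in> A)"
    (is "?blocks \<longleftrightarrow> ?gens")
proof -
  let ?swap = "\<forall>x \<in> X. \<forall>y \<in> X.
    (fst (r (x, y)) \<in> A \<longleftrightarrow> y \<in> A) \<and> (snd (r (x, y)) \<in> A \<longleftrightarrow> x \<in> A)"
  have "?blocks \<longleftrightarrow> ?swap"
  proof
    assume blocks: ?blocks
    show ?swap
    proof (intro ballI)
      fix x y assume xy: "x \<in> X" "y \<in> X"
      define P where "P = (if x \<in> A then A else X - A)"
      define Q where "Q = (if y \<in> A then A else X - A)"
      have "r ` (P \<times> Q) = Q \<times> P"
        using blocks by (simp add: P_def Q_def)
      moreover have "(x, y) \<in> P \<times> Q"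
        using xy by (simp add: P_def Q_def)
      ultimately have "r (x, y) \<in> Q \<times> P"
        by blast
      then show "(fst (r (x, y)) \<in> A \<longleftrightarrow> y \<in> A) \<and> (snd (r (x, y)) \<in> A \<longleftrightarrow> x \<in> A)"
        by (auto simp: P_def Q_def mem_Times_iff split: if_splits)
    qed
  next
    assume swap: ?swap
    have into: "r (x, y) \<in> X \<times> X" if "x \<in> X" "y \<in> X" for x y
      using bij_betwE[OF rb] that by auto
    show ?blocks
    proof (intro ballI equalityI subsetI)
      fix P Q t assume PQ: "P \<in> {A, X - A}" "Q \<in> {A, X - A}" and "t \<in> r ` (P \<times> Q)"
      then obtain x y where xy: "x \<in> P" "y \<in> Q" "t = r (x, y)"
        by auto
      then have "x \<in> X" "y \<in> X"
        using PQ A by auto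
      then show "t \<in> Q \<times> P"
        using swap into xy PQ by (auto simp: mem_Times_iff)
    next
      fix P Q t assume PQ: "P \<in> {A, X - A}" "Q \<in> {A, X - A}" and t: "t \<in> Q \<times> P"
      then have "t \<in> r ` (X \<times> X)"
        using bij_betw_imp_surj_on[OF rb] A by auto
      then obtain x y where xy: "x \<in> X" "y \<in> X" "t = r (x, y)"
        by auto
      then have "x \<in> P" "y \<in> Q"
        using swap t PQ by (auto simp: mem_Times_iff)
      then show "t \<in> r ` (P \<times> Q)"
        using xy by auto
    qed
  qed
  also have "?swap \<longleftrightarrow> ?gens"
  proof
    assume swap: ?swap
    have "eta_map X r z x \<in> A \<longleftrightarrow> x \<in> A" if "z \<in> X" "x \<in> X" for z x
    proof -
      have "z \<in> lambda_map X r x ` X"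
        using nd that by (simp add: nondegenerate_def Bij_def bij_betw_def)
      then obtain y where "y \<in> X" "z = lambda_map X r x y"
        by auto
      then show ?thesis
        using swap solution_via_eta[OF nd \<open>x \<in> X\<close> \<open>y \<in> X\<close>] that by (metis snd_conv)
    qed
    then show ?gens
      using swap by (auto simp: lambda_map_def)
  next
    assume gens: ?gens
    have "lambda_map X r x y \<in> X" if "x \<in> X" "y \<in> X" for x y
      using nd that Bij_imp_funcset by (fastforce simp: nondegenerate_def)
    then show ?swap
      using gens by (simp add: solution_via_eta[OF nd])
  qed
  finally show ?thesis .
qed

lemma decomposable_iff_block_swap:
  "decomposable X r \<longleftrightarrow>
    (\<exists>A \<subset> X. A \<noteq> {} \<and> (\<forall>P \<in> {A, X - A}. \<forall>Q \<in> {A, X - A}. r ` (P \<times> Q) = Q \<times> P))"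
proof
  assume "decomposable X r"
  then obtain A B where AB: "A \<noteq> B" "partition_on X {A, B}"
    and swap: "\<forall>P \<in> {A, B}. \<forall>Q \<in> {A, B}. r ` (P \<times> Q) = Q \<times> P"
    by (auto simp only: decomposable_def)
  from AB have "A \<union> B = X" "A \<inter> B = {}" "A \<noteq> {}" "B \<noteq> {}"
    by (auto simp: partition_on_def disjoint_def)
  then have "A \<subset> X" "B = X - A"
    by auto
  then show "\<exists>A \<subset> X. A \<noteq> {} \<and> (\<forall>P \<in> {A, X - A}. \<forall>Q \<in> {A, X - A}. r ` (P \<times> Q) = Q \<times> P)"
    using swap \<open>A \<noteq> {}\<close> by (intro exI[of _ A]) simp
next
  assume "\<exists>A \<subset> X. A \<noteq> {} \<and> (\<forall>P \<in> {A, X - A}. \<forall>Q \<in> {A, X - A}. r ` (P \<times> Q) = Q \<times> P)"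
  then obtain A where A: "A \<subset> X" "A \<noteq> {}"
    and swap: "\<forall>P \<in> {A, X - A}. \<forall>Q \<in> {A, X - A}. r ` (P \<times> Q) = Q \<times> P"
    by blast
  have "A \<noteq> X - A" "partition_on X {A, X - A}"
    using A by (auto simp: partition_on_def disjoint_def)
  then show "decomposable X r"
    unfolding decomposable_def using swap by (intro exI[of _ A] exI[of _ "X - A"] conjI)
qed

lemma permutation_group_action:
  assumes "bij_betw r (X \<times> X) (X \<times> X)" "nondegenerate X r"
  shows "group_action (permutation_group X r) X (\<lambda>g. g)"
proof -
  interpret B: group "BijGroup X"
    by (rule group_BijGroup)
  have "group_action (BijGroup X) X (\<lambda>g. g)"
    by (auto simp: group_action_def group_hom_def group_hom_axioms_def hom_def B.group_axioms)
  then show ?thesis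
    using group_action.induced_action[OF _ subgroup_permutation_group[OF assms]]
    by (simp add: permutation_group_def)
qed

theorem theorem1p2:
  fixes X :: "'a set" and r :: "'a \<times> 'a \<Rightarrow> 'a \<times> 'a"
  assumes "finite X"
    and "ybe_solution X r"
    and "bij_betw r (X \<times> X) (X \<times> X)"
    and "nondegenerate X r"
  shows "indecomposable X r \<longleftrightarrow> transitive_action (permutation_group X r) X (\<lambda>g. g)"
proof -
  note rb = assms(3) and nd = assms(4)
  let ?H = "lambda_map X r ` X \<union> eta_map X r ` X"
  have H: "?H \<subseteq> Bij X"
    using nd eta_map_in_Bij[OF rb nd] by (auto simp: nondegenerate_def)
  have "decomposable X r \<longleftrightarrow>
    (\<exists>A \<subset> X. A \<noteq> {} \<and> (\<forall>h \<in> ?H. \<forall>x \<in> X. h x \<in> A \<longleftrightarrow> x \<in> A))"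
    unfolding decomposable_iff_block_swap
    by (intro ex_cong1 conj_cong refl block_swap_iff_generators_preserve[OF rb nd] psubset_imp_subset)
  also have "\<dots> \<longleftrightarrow> (\<exists>A \<subset> X. A \<noteq> {} \<and>
    (\<forall>g \<in> carrier (permutation_group X r). \<forall>x \<in> X. g x \<in> A \<longleftrightarrow> x \<in> A))"
    by (simp add: permutation_group_def generate_preserves_iff[OF H])
  finally show ?thesis
    using transitive_action_iff_no_invariant[OF permutation_group_action[OF rb nd]] by simp
qed

end
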